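(* Let $\beta_s\ge0$ be a user-defined coefficient (which need not be a fixed constant: it may be defined locally at each element interface, e.g. $\beta_s=\max_{i=1,2}(|u_i^-|,|u_i^+|)$). For $\mathbf u^\pm\in\Omega$ (the Baer–Nunziato phase space of the context) define $\mathbf h(\mathbf u^-,\mathbf u^+)\in\mathbb R^7$ and $\mathbf d^\pm(\mathbf u^-,\mathbf u^+)\in\mathbb R^7$ (with the vector convention of the context) by $$\mathbf h(\mathbf u^-,\mathbf u^+)=\begin{pmatrix}0\\ h_{\rho_i}\\ h_{\rho u_i}\\ h_{\rho E_i}\end{pmatrix}-\beta_s\frac{[\![\alpha_i]\!]}2\begin{pmatrix}1\\ \tilde h_{\rho_i}\\ \tilde h_{\rho u_i}\\ \tilde h_{\rho E_i}\end{pmatrix},\qquad \mathbf d^\pm(\mathbf u^-,\mathbf u^+)=\frac{[\![\alpha_i]\!]}2\begin{pmatrix}u_I^\pm\\ 0\\ -p_I^\pm\\ -p_I^\pm u_I^\pm\end{pmatrix},$$ where $$h_{\rho_i}=\overline\alpha_i\overline u_i\hat\rho_i,\quad h_{\rho u_i}=\overline\alpha_i\Big(\overline u_i^2\hat\rho_i+\frac{\overline{p_i\theta_i}}{\overline\theta_i}\Big),\quad h_{\rho E_i}=\overline\alpha_i\overline u_i\Big(\hat\rho_i\Big(\frac{C_{v,i}}{\hat\theta_i}+\frac{u_i^-u_i^+}2\Big)+\frac{\overline{p_i\theta_i}}{\overline\theta_i}+p_{\infty,i}\Big),$$ $$\tilde h_{\rho_i}=\hat\rho_i,\quad\tilde h_{\rho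 u_i}=\hat\rho_i\overline u_i,\quad\tilde h_{\rho E_i}=\hat\rho_i\Big(\frac{C_{v,i}}{\hat\theta_i}+\frac{u_i^-u_i^+}2\Big)+p_{\infty,i}.$$ Then the numerical fluxes $$\mathbf D^-_{ec}(\mathbf u^-,\mathbf u^+)=\mathbf h(\mathbf u^-,\mathbf u^+)-\mathbf f(\mathbf u^-)+\mathbf d^-(\mathbf u^-,\mathbf u^+),\quad \mathbf D^+_{ec}(\mathbf u^-,\mathbf u^+)=\mathbf f(\mathbf u^+)-\mathbf h(\mathbf u^-,\mathbf u^+)+\mathbf d^+(\mathbf u^-,\mathbf u^+)$$ are consistent and entropy conservative in the sense of the context for the Baer–Nunziato model, and they satisfy the following: there exist matrix-valued functions $\mathcal C^\pm$ such that, with $\mathcal C:=\mathcal C^++\mathcal C^-$, $$\mathbf d^\pm(\mathbf u^-,\mathbf u^+)=\mathcal C^\pm(\mathbf u^-,\mathbf u^+)[\![\mathbf u]\!],\quad \mathcal C(\mathbf u^-,\mathbf u^+)+\mathcal C(\mathbf u^+,\mathbf u^-)=\mathbf c(\mathbf u^-)+\mathbf c(\mathbf u^+),\quad\mathcal C(\mathbf u,\mathbf u)=\mathbf c(\mathbf u)$$ for all $\mathbf u,\mathbf u^\pm\in\Omega$.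
   Context: **Model.** Fix constants $C_{v,i}>0$, $\gamma_i>1$, $p_{\infty,i}\ge0$ ($i=1,2$) and $\chi\in\{0,\frac12,1\}$. The unknown is $$\mathbf u=(\alpha_1,\ \alpha_1\rho_1,\ \alpha_1\rho_1u_1,\ \alpha_1\rho_1E_1,\ \alpha_2\rho_2,\ \alpha_2\rho_2u_2,\ \alpha_2\rho_2E_2)^\top\in\mathbb R^7,\qquad \alpha_2=1-\alpha_1,$$ with void fractions $\alpha_i$, densities $\rho_i$, velocities $u_i$, specific total energies $E_i=e_i+u_i^2/2$, where $e_i$ is the specific internal energy. Pressure: $p_i=(\gamma_i-1)\rho_ie_i-\gamma_ip_{\infty,i}$ (stiffened gas). The temperature $T_i$ is defined by $\rho_ie_i=\rho_iC_{v,i}T_i+p_{\infty,i}$, and $\theta_i=1/T_i$. The phase space $\Omega$ is the set of $\mathbf u$ with $0<\alpha_i<1$, $\rho_i>0$, $u_i\in\mathbb R$, $e_i>0$ and $T_i>0$, $i=1,2$. **Vector convention.** A column $(a_i,b_i,c_i,d_i)^\top$, $i=1,2$, denotes the vector $(a_1,b_1,c_1,d_1,b_2,c_2,d_2)^\top\in\mathbb R^7$ (the first line is the void fraction equation, written for phase 1 only); a prefactor depending on $i$ multiplies the entries of phase $i$. **Flux and nonconservative product.** The Baer–Nunziato system is $\partial_t\mathbf u+\partial_x\mathbf f(\mathbf u)+\mathbf c(\mathbf u)\partial_x\mathbf u=0$ with $\mathbf f(\mathbf u)=(0,\alpha_i\rho_iu_i,\alpha_i(\rho_iu_i^2+p_i),\alpha_iu_i(\rho_iE_i+p_i))^\top$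 and $\mathbf c(\mathbf u)\partial_x\mathbf u=\partial_x\alpha_i\,(u_I,0,-p_I,-p_Iu_I)^\top$, $\partial_x\alpha_2=-\partial_x\alpha_1$, so only the first column of $\mathbf c(\mathbf u)\in\mathbb R^{7\times7}$ is nonzero. Interface quantities: $u_I=\beta u_1+(1-\beta)u_2$, $p_I=\mu p_1+(1-\mu)p_2$, $\beta=\frac{\chi\alpha_1\rho_1}{\chi\alpha_1\rho_1+(1-\chi)\alpha_2\rho_2}$, $\mu=\frac{(1-\beta)T_2}{\beta T_1+(1-\beta)T_2}$; $u_I^\pm,p_I^\pm$ are their values at $\mathbf u^\pm$. **Entropy.** $s_i=-C_{v,i}(\ln\theta_i+(\gamma_i-1)\ln\rho_i)$, $\eta(\mathbf u)=-\sum_{i=1}^2\alpha_i\rho_is_i$, $q(\mathbf u)=-\sum_{i=1}^2\alpha_i\rho_iu_is_i$, $\mathbf v(\mathbf u)=\eta'(\mathbf u)$ (the entropy variables). **Means and jumps.** For a quantity $a$ with values $a^\pm$ at $\mathbf u^\pm$: $[\![a]\!]=a^+-a^-$, $\overline a=\frac{a^++a^-}2$ (e.g. $\overline{p_i\theta_i}$ is the mean of the product), and for $a^\pm>0$ the logarithmic mean $\hat a=[\![a]\!]/[\![\ln a]\!]$, with $\hat a=a^-$ if $a^-=a^+$. **Definitions.** The fluxes $\mathbf D^\pm_{ec}$ are consistent if $\mathbf h(\mathbf u,\mathbf u)=\mathbf f(\mathbf u)$ and $\mathbf d^\pm(\mathbf u,\mathbf u)=0$ for all $\mathbf u\in\Omega$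 (hence $\mathbf D^\pm_{ec}(\mathbf u,\mathbf u)=0$). Lipschitz continuous and consistent numerical fluxes in fluctuation form $\mathbf D^\pm_{ec}$ are said to be entropy conservative, for the entropy–entropy flux pair $(\eta,q)$, if $\mathbf v(\mathbf u^-)^\top\mathbf D^-_{ec}(\mathbf u^-,\mathbf u^+)+\mathbf v(\mathbf u^+)^\top\mathbf D^+_{ec}(\mathbf u^-,\mathbf u^+)=q(\mathbf u^+)-q(\mathbf u^-)$ for all $\mathbf u^\pm\in\Omega$.
   Formalization: "Lipschitz continuous" is taken as locally Lipschitz on Ω×Ω (global fails), and this part of entropy conservativity is claimed only for locally Lipschitz β_s, as it fails for discontinuous β_s; consistency, the entropy identity and the C^± relations are proved for every β_s. *)

theory Defs
  imports "HOL-Analysis.Analysis"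
begin

text \<open>
  Phases are indexed by the numeral type \<open>2\<close>, whose two elements are \<open>1\<close> and \<open>2\<close>
  (as an element of that type, \<open>2 = 0\<close>).  States are vectors
  \<open>(alpha_1, alpha_1 rho_1, alpha_1 rho_1 u_1, alpha_1 rho_1 E_1,
     alpha_2 rho_2, alpha_2 rho_2 u_2, alpha_2 rho_2 E_2)\<close>.
\<close>

type_synonym state = "real ^ 7"

record bn_model =
  Cv :: "2 \<Rightarrow> real"
  gam :: "2 \<Rightarrow> real"
  pinf :: "2 \<Rightarrow> real"
  chi :: real

subsection \<open>Vector convention, jumps and means\<close>

text \<open>The column with prefactor \<open>k i\<close> and entries \<open>a i, b i, c i, d i\<close>; its first line is
  kept for phase 1 only.\<close>
definition pcol :: "(2 \<Rightarrow> real) \<Rightarrow> (2 \<Rightarrow> real) \<Rightarrow> (2 \<Rightarrow> real) \<Rightarrow> (2 \<Rightarrow> real) \<Rightarrow> (2 \<Rightarrow> real) \<Rightarrow> real ^ 7"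
  where "pcol k a b c d =
    vector [k 1 * a 1, k 1 * b 1, k 1 * c 1, k 1 * d 1, k 2 * b 2, k 2 * c 2, k 2 * d 2]"

definition jump :: "(state \<Rightarrow> real) \<Rightarrow> state \<Rightarrow> state \<Rightarrow> real"
  where "jump a um up = a up - a um"

definition mean :: "(state \<Rightarrow> real) \<Rightarrow> state \<Rightarrow> state \<Rightarrow> real"
  where "mean a um up = (a up + a um) / 2"

definition log_mean :: "(state \<Rightarrow> real) \<Rightarrow> state \<Rightarrow> state \<Rightarrow> real"
  where "log_mean a um up =
    (if a um = a up then a um else jump a um up / jump (\<lambda>u. ln (a u)) um up)"

subsection \<open>The Baer--Nunziato model\<close>

definition alpha :: "2 \<Rightarrow> state \<Rightarrow> real"
  where "alpha i u = (if i = 1 then u $ 1 else 1 - u $ 1)"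

definition alpha_rho :: "2 \<Rightarrow> state \<Rightarrow> real"
  where "alpha_rho i u = (if i = 1 then u $ 2 else u $ 5)"

definition alpha_rho_u :: "2 \<Rightarrow> state \<Rightarrow> real"
  where "alpha_rho_u i u = (if i = 1 then u $ 3 else u $ 6)"

definition alpha_rho_E :: "2 \<Rightarrow> state \<Rightarrow> real"
  where "alpha_rho_E i u = (if i = 1 then u $ 4 else u $ 7)"

definition rho :: "2 \<Rightarrow> state \<Rightarrow> real"
  where "rho i u = alpha_rho i u / alpha i u"

definition vel :: "2 \<Rightarrow> state \<Rightarrow> real"
  where "vel i u = alpha_rho_u i u / alpha_rho i u"

definition tot_energy :: "2 \<Rightarrow> state \<Rightarrow> real"
  where "tot_energy i u = alpha_rho_E i u / alpha_rho i u"

definition int_energy :: "2 \<Rightarrow> state \<Rightarrow> real"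
  where "int_energy i u = tot_energy i u - (vel i u)\<^sup>2 / 2"

definition pressure :: "bn_model \<Rightarrow> 2 \<Rightarrow> state \<Rightarrow> real"
  where "pressure M i u = (gam M i - 1) * rho i u * int_energy i u - gam M i * pinf M i"

text \<open>The relation \<open>rho_i e_i = rho_i C_{v,i} T_i + p_{infty,i}\<close> solved for \<open>T_i\<close>.\<close>
definition temp :: "bn_model \<Rightarrow> 2 \<Rightarrow> state \<Rightarrow> real"
  where "temp M i u = (rho i u * int_energy i u - pinf M i) / (rho i u * Cv M i)"

definition theta :: "bn_model \<Rightarrow> 2 \<Rightarrow> state \<Rightarrow> real"
  where "theta M i u = 1 / temp M i u"

definition phase_space :: "bn_model \<Rightarrow> state set"
  where "phase_space M = {u. \<forall>i. 0 < alpha i u \<and> alpha i u < 1 \<and> 0 < rho i u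
                               \<and> 0 < int_energy i u \<and> 0 < temp M i u}"

definition beta :: "bn_model \<Rightarrow> state \<Rightarrow> real"
  where "beta M u = chi M * alpha_rho 1 u / (chi M * alpha_rho 1 u + (1 - chi M) * alpha_rho 2 u)"

definition mu :: "bn_model \<Rightarrow> state \<Rightarrow> real"
  where "mu M u = (1 - beta M u) * temp M 2 u / (beta M u * temp M 1 u + (1 - beta M u) * temp M 2 u)"

definition u_I :: "bn_model \<Rightarrow> state \<Rightarrow> real"
  where "u_I M u = beta M u * vel 1 u + (1 - beta M u) * vel 2 u"

definition p_I :: "bn_model \<Rightarrow> state \<Rightarrow> real"
  where "p_I M u = mu M u * pressure M 1 u + (1 - mu M u) * pressure M 2 u"

definition flux :: "bn_model \<Rightarrow> state \<Rightarrow> real ^ 7"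
  where "flux M u = pcol (\<lambda>i. 1)
    (\<lambda>i. 0)
    (\<lambda>i. alpha i u * rho i u * vel i u)
    (\<lambda>i. alpha i u * (rho i u * (vel i u)\<^sup>2 + pressure M i u))
    (\<lambda>i. alpha i u * vel i u * (rho i u * tot_energy i u + pressure M i u))"

text \<open>Only the column multiplying the derivative of \<open>alpha_1\<close> is nonzero; in it the entries of
  phase 2 change sign because the derivative of \<open>alpha_2\<close> is minus that of \<open>alpha_1\<close>.\<close>
definition nc_matrix :: "bn_model \<Rightarrow> state \<Rightarrow> real ^ 7 ^ 7"
  where "nc_matrix M u = (\<chi> k l. if l = 1
    then pcol (\<lambda>i. if i = 1 then 1 else - 1)
           (\<lambda>i. u_I M u) (\<lambda>i. 0) (\<lambda>i. - p_I M u) (\<lambda>i. - (p_I M u * u_I M u)) $ k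
    else 0)"

subsection \<open>Entropy\<close>

definition spec_entropy :: "bn_model \<Rightarrow> 2 \<Rightarrow> state \<Rightarrow> real"
  where "spec_entropy M i u = - Cv M i * (ln (theta M i u) + (gam M i - 1) * ln (rho i u))"

definition eta :: "bn_model \<Rightarrow> state \<Rightarrow> real"
  where "eta M u = - (\<Sum>i\<in>UNIV. alpha i u * rho i u * spec_entropy M i u)"

definition entropy_flux :: "bn_model \<Rightarrow> state \<Rightarrow> real"
  where "entropy_flux M u = - (\<Sum>i\<in>UNIV. alpha i u * rho i u * vel i u * spec_entropy M i u)"

definition entropy_vars :: "(state \<Rightarrow> real) \<Rightarrow> state \<Rightarrow> real ^ 7"
  where "entropy_vars h u = (\<chi> k. frechet_derivative h (at u) (axis k 1))"

subsection \<open>Fluxes in fluctuation form\<close>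

definition fluct_minus ::
  "(state \<Rightarrow> real ^ 7) \<Rightarrow> (state \<Rightarrow> state \<Rightarrow> real ^ 7) \<Rightarrow> (state \<Rightarrow> state \<Rightarrow> real ^ 7) \<Rightarrow> state \<Rightarrow> state \<Rightarrow> real ^ 7"
  where "fluct_minus f h d um up = h um up - f um + d um up"

definition fluct_plus ::
  "(state \<Rightarrow> real ^ 7) \<Rightarrow> (state \<Rightarrow> state \<Rightarrow> real ^ 7) \<Rightarrow> (state \<Rightarrow> state \<Rightarrow> real ^ 7) \<Rightarrow> state \<Rightarrow> state \<Rightarrow> real ^ 7"
  where "fluct_plus f h d um up = f up - h um up + d um up"

definition consistent ::
  "state set \<Rightarrow> (state \<Rightarrow> real ^ 7) \<Rightarrow> (state \<Rightarrow> state \<Rightarrow> real ^ 7)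
    \<Rightarrow> (state \<Rightarrow> state \<Rightarrow> real ^ 7) \<Rightarrow> (state \<Rightarrow> state \<Rightarrow> real ^ 7) \<Rightarrow> bool"
  where "consistent S f h dm dp \<longleftrightarrow> (\<forall>u\<in>S. h u u = f u \<and> dm u u = 0 \<and> dp u u = 0)"

text \<open>Local Lipschitz continuity jointly in both states; the fluxes grow superlinearly in the
  conserved variables and are not globally Lipschitz on the phase space.\<close>
definition lipschitz_pair :: "state set \<Rightarrow> (state \<Rightarrow> state \<Rightarrow> 'b::metric_space) \<Rightarrow> bool"
  where "lipschitz_pair S g \<longleftrightarrow>
    (\<forall>z\<in>S \<times> S. \<exists>r>0. \<exists>L. L-lipschitz_on (cball z r \<inter> S \<times> S) (\<lambda>(um, up). g um up))"

definition entropy_balance ::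
  "state set \<Rightarrow> (state \<Rightarrow> real) \<Rightarrow> (state \<Rightarrow> real)
    \<Rightarrow> (state \<Rightarrow> state \<Rightarrow> real ^ 7) \<Rightarrow> (state \<Rightarrow> state \<Rightarrow> real ^ 7) \<Rightarrow> bool"
  where "entropy_balance S et q Dm Dp \<longleftrightarrow>
    (\<forall>um\<in>S. \<forall>up\<in>S.
       entropy_vars et um \<bullet> Dm um up + entropy_vars et up \<bullet> Dp um up = q up - q um)"

definition entropy_conservative ::
  "state set \<Rightarrow> (state \<Rightarrow> real) \<Rightarrow> (state \<Rightarrow> real) \<Rightarrow> (state \<Rightarrow> real ^ 7) \<Rightarrow> (state \<Rightarrow> state \<Rightarrow> real ^ 7)
    \<Rightarrow> (state \<Rightarrow> state \<Rightarrow> real ^ 7) \<Rightarrow> (state \<Rightarrow> state \<Rightarrow> real ^ 7) \<Rightarrow> bool"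
  where "entropy_conservative S et q f h dm dp \<longleftrightarrow>
    lipschitz_pair S (fluct_minus f h dm) \<and> lipschitz_pair S (fluct_plus f h dp)
    \<and> consistent S f h dm dp
    \<and> entropy_balance S et q (fluct_minus f h dm) (fluct_plus f h dp)"

subsection \<open>The numerical fluxes\<close>

definition p_theta_ratio :: "bn_model \<Rightarrow> 2 \<Rightarrow> state \<Rightarrow> state \<Rightarrow> real"
  where "p_theta_ratio M i um up =
    mean (\<lambda>u. pressure M i u * theta M i u) um up / mean (theta M i) um up"

definition energy_mean :: "bn_model \<Rightarrow> 2 \<Rightarrow> state \<Rightarrow> state \<Rightarrow> real"
  where "energy_mean M i um up =
    log_mean (rho i) um up * (Cv M i / log_mean (theta M i) um up + vel i um * vel i up / 2)"

definition h_flux :: "bn_model \<Rightarrow> (state \<Rightarrow> state \<Rightarrow> real) \<Rightarrow> state \<Rightarrow> state \<Rightarrow> real ^ 7"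
  where "h_flux M bs um up =
    pcol (\<lambda>i. 1)
      (\<lambda>i. 0)
      (\<lambda>i. mean (alpha i) um up * mean (vel i) um up * log_mean (rho i) um up)
      (\<lambda>i. mean (alpha i) um up *
            ((mean (vel i) um up)\<^sup>2 * log_mean (rho i) um up + p_theta_ratio M i um up))
      (\<lambda>i. mean (alpha i) um up * mean (vel i) um up *
            (energy_mean M i um up + p_theta_ratio M i um up + pinf M i))
    - bs um up *\<^sub>R
      pcol (\<lambda>i. jump (alpha i) um up / 2)
      (\<lambda>i. 1)
      (\<lambda>i. log_mean (rho i) um up)
      (\<lambda>i. log_mean (rho i) um up * mean (vel i) um up)
      (\<lambda>i. energy_mean M i um up + pinf M i)"

definition d_col :: "bn_model \<Rightarrow> state \<Rightarrow> state \<Rightarrow> state \<Rightarrow> real ^ 7"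
  where "d_col M w um up =
    pcol (\<lambda>i. jump (alpha i) um up / 2)
      (\<lambda>i. u_I M w) (\<lambda>i. 0) (\<lambda>i. - p_I M w) (\<lambda>i. - (p_I M w * u_I M w))"

definition d_minus :: "bn_model \<Rightarrow> state \<Rightarrow> state \<Rightarrow> real ^ 7"
  where "d_minus M um up = d_col M um um up"

definition d_plus :: "bn_model \<Rightarrow> state \<Rightarrow> state \<Rightarrow> real ^ 7"
  where "d_plus M um up = d_col M up um up"

end

theory Submission
  imports Defs
begin

text \<open>
  Pairing the entropy variables with a column splits into one contribution per phase.  In
  the contribution of phase \<open>i\<close>, the logarithmic means turn the jump of
  \<open>s\<^sub>i\<close> into jumps of \<open>rho\<^sub>i\<close> and \<open>theta\<^sub>i\<close>, so that the \<open>beta_s\<close> term is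
  orthogonal to the jump of the entropy variables and the rest of \<open>h\<close> produces
  the mean of \<open>alpha\<^sub>i\<close> times the jump of \<open>p\<^sub>i theta\<^sub>i u\<^sub>i\<close>.  The nonconservative part
  produces the product with mean and jump exchanged, up to the terms
  \<open>(p\<^sub>I - p\<^sub>i)(u\<^sub>I - u\<^sub>i) theta\<^sub>i\<close>, which agree for the two phases and hence cancel because
  the jumps of the void fractions are opposite.  The matrices are halves of the
  nonconservative matrix at the left and at the right state.
\<close>

subsection \<open>Local Lipschitz continuity\<close>

text \<open>The local notion of \<open>lipschitz_pair\<close> for functions of one argument on any
  metric space, so that closure rules can be chained; a function of two states is treated as a
  function on a product set.\<close>

definition loc_lip :: "'a::metric_space set \<Rightarrow> ('a \<Rightarrow> 'b::metric_space) \<Rightarrow> bool"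
  where "loc_lip S f \<longleftrightarrow> (\<forall>z\<in>S. \<exists>r>0. \<exists>L. L-lipschitz_on (cball z r \<inter> S) f)"

lemma loc_lipI:
  assumes "\<And>z. z \<in> S \<Longrightarrow> \<exists>r>0. \<exists>L. L-lipschitz_on (cball z r \<inter> S) f"
  shows "loc_lip S f"
  using assms by (auto simp: loc_lip_def)

lemma lipschitz_imp_loc_lip: "L-lipschitz_on S f \<Longrightarrow> loc_lip S f"
  by (meson Int_lower2 lipschitz_on_subset loc_lipI zero_less_one)

lemma loc_lip_const: "loc_lip S (\<lambda>x. c)"
  by (rule lipschitz_imp_loc_lip[OF lipschitz_on_constant])

lemma (in bounded_linear) loc_lip: "loc_lip S f"
  using lipschitz_boundE lipschitz_imp_loc_lip by blast

lemma loc_lip_compose: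
  assumes f: "loc_lip S f" and g: "loc_lip T g" and im: "\<And>x. x \<in> S \<Longrightarrow> f x \<in> T"
  shows "loc_lip S (\<lambda>x. g (f x))"
proof (rule loc_lipI)
  fix z assume z: "z \<in> S"
  obtain r L where r: "r > 0" and L: "L-lipschitz_on (cball z r \<inter> S) f"
    using f z by (auto simp: loc_lip_def)
  obtain r' K where r': "r' > 0" and K: "K-lipschitz_on (cball (f z) r' \<inter> T) g"
    using g im[OF z] by (auto simp: loc_lip_def)
  have L0: "L \<ge> 0" using L by (rule lipschitz_on_nonneg)
  \<comment> \<open>This radius makes \<open>f\<close> map the small ball into the ball of radius
    \<open>r'\<close> around \<open>f z\<close>; dividing by \<open>L + 1\<close> instead of
    \<open>L\<close> covers \<open>L = 0\<close>.\<close>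
  define s where "s = min r (r' / (L + 1))"
  have s: "s > 0" using r r' L0 by (simp add: s_def)
  have sub: "f ` (cball z s \<inter> S) \<subseteq> cball (f z) r' \<inter> T"
  proof safe
    fix x assume x: "x \<in> cball z s" "x \<in> S"
    have "dist (f z) (f x) \<le> L * dist z x"
      using lipschitz_onD[OF L, of z x] x z r by (auto simp: s_def)
    also have "\<dots> \<le> (L + 1) * (r' / (L + 1))"
      using x L0 by (intro mult_mono) (auto simp: s_def)
    finally show "f x \<in> cball (f z) r'" using L0 by simp
  qed (use im in auto)
  have "(K * L)-lipschitz_on (cball z s \<inter> S) (\<lambda>x. g (f x))"
    by (rule lipschitz_on_compose2[OF lipschitz_on_subset[OF L] lipschitz_on_subset[OF K sub]])
       (auto simp: s_def)
  then show "\<exists>r>0. \<exists>L. L-lipschitz_on (cball z r \<inter> S) (\<lambda>x. g (f x))"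
    using s by blast
qed

lemma loc_lip_Pair:
  assumes "loc_lip S f" "loc_lip S g"
  shows "loc_lip S (\<lambda>x. (f x, g x))"
proof (rule loc_lipI)
  fix z assume z: "z \<in> S"
  obtain r L where r: "r > 0" and L: "L-lipschitz_on (cball z r \<inter> S) f"
    using assms z by (auto simp: loc_lip_def)
  obtain r' K where r': "r' > 0" and K: "K-lipschitz_on (cball z r' \<inter> S) g"
    using assms z by (auto simp: loc_lip_def)
  have "\<exists>B. B-lipschitz_on (cball z (min r r') \<inter> S) (\<lambda>x. (f x, g x))"
    using lipschitz_on_Pair[OF lipschitz_on_subset[OF L] lipschitz_on_subset[OF K]]
    by (metis (no_types, lifting) Int_mono cball_min_Int inf.cobounded1 inf.cobounded2 order_refl)
  then show "\<exists>r>0. \<exists>L. L-lipschitz_on (cball z r \<inter> S) (\<lambda>x. (f x, g x))"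
    using r r' by (intro exI[of _ "min r r'"]) auto
qed

text \<open>A bounded bilinear map is Lipschitz on bounded sets, by changing one factor at a time.
  Composing the uncurried map with the pair of functions gives the product rule.\<close>

lemma (in bounded_bilinear) loc_lip_prod:
  assumes "loc_lip S f" "loc_lip S g"
  shows "loc_lip S (\<lambda>x. prod (f x) (g x))"
proof -
  obtain K where K: "K > 0" "\<And>a b. norm (prod a b) \<le> norm a * norm b * K"
    using pos_bounded by blast
  have "loc_lip UNIV (\<lambda>p. prod (fst p) (snd p))"
  proof (rule loc_lipI)
    fix z :: "'a \<times> 'b"
    let ?N = "norm z + 1"
    have bd: "norm (fst p) \<le> ?N" "norm (snd p) \<le> ?N" if "p \<in> cball z 1" for p
    proof -
      have "norm p \<le> ?N"
        using that norm_triangle_ineq3[of p z] by (auto simp: dist_norm norm_minus_commute)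
      then show "norm (fst p) \<le> ?N" "norm (snd p) \<le> ?N"
        using norm_fst_le[of "fst p" "snd p"] norm_snd_le[of "snd p" "fst p"] by auto
    qed
    have "(2 * ?N * K)-lipschitz_on (cball z 1) (\<lambda>p. prod (fst p) (snd p))"
    proof (rule lipschitz_onI)
      fix p q assume p: "p \<in> cball z 1" and q: "q \<in> cball z 1"
      have "prod (fst p) (snd p) - prod (fst q) (snd q)
          = prod (fst p - fst q) (snd p) + prod (fst q) (snd p - snd q)"
        by (simp add: diff_left diff_right)
      then have "norm (prod (fst p) (snd p) - prod (fst q) (snd q))
          \<le> norm (prod (fst p - fst q) (snd p)) + norm (prod (fst q) (snd p - snd q))"
        by (simp add: norm_triangle_ineq)
      also have "\<dots> \<le> norm (fst p - fst q) * norm (snd p) * K + norm (fst q) * norm (snd p - snd q) * K"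
        using K(2) by (intro add_mono) auto
      also have "\<dots> \<le> dist p q * ?N * K + ?N * dist p q * K"
        using K(1) bd[OF p] bd[OF q] dist_fst_le[of p q] dist_snd_le[of p q]
        by (intro add_mono mult_mono) (auto simp: dist_norm)
      finally show "dist (prod (fst p) (snd p)) (prod (fst q) (snd q)) \<le> 2 * ?N * K * dist p q"
        by (simp add: dist_norm algebra_simps)
    qed (use K in auto)
    then show "\<exists>r>0. \<exists>L. L-lipschitz_on (cball z r \<inter> UNIV) (\<lambda>p. prod (fst p) (snd p))"
      by (intro exI[of _ 1]) auto
  qed
  from loc_lip_compose[OF loc_lip_Pair[OF assms] this] show ?thesis by simp
qed

lemmas loc_lip_mult = bounded_bilinear.loc_lip_prod[OF bounded_bilinear_mult]
lemmas loc_lip_scaleR = bounded_bilinear.loc_lip_prod[OF bounded_bilinear_scaleR]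

lemma loc_lip_add:
  fixes f g :: "'a::metric_space \<Rightarrow> 'b::real_normed_vector"
  assumes "loc_lip S f" "loc_lip S g"
  shows "loc_lip S (\<lambda>x. f x + g x)"
  using loc_lip_compose[OF loc_lip_Pair[OF assms] bounded_linear.loc_lip[of "\<lambda>p. fst p + snd p" UNIV]]
  by (simp add: bounded_linear_add bounded_linear_fst bounded_linear_snd)

lemma loc_lip_minus:
  fixes f :: "'a::metric_space \<Rightarrow> 'b::real_normed_vector"
  assumes "loc_lip S f"
  shows "loc_lip S (\<lambda>x. - f x)"
  using loc_lip_compose[OF assms bounded_linear.loc_lip[of uminus UNIV]]
  by (simp add: bounded_linear_minus)

lemma loc_lip_diff:
  fixes f g :: "'a::metric_space \<Rightarrow> 'b::real_normed_vector"
  assumes "loc_lip S f" "loc_lip S g"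
  shows "loc_lip S (\<lambda>x. f x - g x)"
  using loc_lip_add[OF assms(1) loc_lip_minus[OF assms(2)]] by simp

lemma loc_lip_power2:
  fixes f :: "'a::metric_space \<Rightarrow> real"
  shows "loc_lip S f \<Longrightarrow> loc_lip S (\<lambda>x. (f x)\<^sup>2)"
  unfolding power2_eq_square by (rule loc_lip_mult)

section \<open>Quotients and vector-valued functions\<close>

lemma abs_inverse_diff_le:
  fixes x y m :: real
  assumes "0 < m" "m \<le> x" "m \<le> y"
  shows "\<bar>1 / x - 1 / y\<bar> \<le> \<bar>x - y\<bar> / m\<^sup>2"
proof -
  have "\<bar>1 / x - 1 / y\<bar> = \<bar>x - y\<bar> / (x * y)"
    using assms by (simp add: field_simps abs_div abs_mult abs_minus_commute)
  also have "\<dots> \<le> \<bar>x - y\<bar> / m\<^sup>2"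
    using assms by (intro divide_left_mono) (auto simp: power2_eq_square intro!: mult_mono)
  finally show ?thesis .
qed

lemma loc_lip_inverse_kernel: "loc_lip {0<..} (\<lambda>x::real. 1 / x)"
proof (rule loc_lipI)
  fix z :: real assume z: "z \<in> {0<..}"
  have "(1 / (z/2)\<^sup>2)-lipschitz_on (cball z (z/2) \<inter> {0<..}) (\<lambda>x. 1 / x)"
  proof (rule lipschitz_onI)
    fix x y assume "x \<in> cball z (z/2) \<inter> {0<..}" "y \<in> cball z (z/2) \<inter> {0<..}"
    then have "\<bar>z - x\<bar> \<le> z/2" "\<bar>z - y\<bar> \<le> z/2" by (auto simp: dist_real_def)
    then have "z/2 \<le> x" "z/2 \<le> y" by linarith+
    with abs_inverse_diff_le[of "z/2" x y] z
    show "dist (1 / x) (1 / y) \<le> 1 / (z/2)\<^sup>2 * dist x y" by (simp add: dist_real_def)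
  qed simp
  then show "\<exists>r>0. \<exists>L. L-lipschitz_on (cball z r \<inter> {0<..}) (\<lambda>x::real. 1 / x)"
    using z by (intro exI[of _ "z/2"]) auto
qed

lemma loc_lip_divide:
  fixes f g :: "'a::metric_space \<Rightarrow> real"
  assumes "loc_lip S f" "loc_lip S g" "\<And>x. x \<in> S \<Longrightarrow> 0 < g x"
  shows "loc_lip S (\<lambda>x. f x / g x)"
  using loc_lip_mult[OF assms(1) loc_lip_compose[OF assms(2) loc_lip_inverse_kernel]] assms(3)
  by simp

lemma loc_lip_divide_const:
  fixes f :: "'a::metric_space \<Rightarrow> real"
  shows "loc_lip S f \<Longrightarrow> loc_lip S (\<lambda>x. f x / c)"
  using loc_lip_mult[OF _ loc_lip_const[of S "1 / c"], of f] by simp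

text \<open>A vector is the finite sum of its components times basis vectors, so the sum and scaling
  rules reduce the claim to components.\<close>

lemma loc_lip_vec:
  fixes f :: "'a::metric_space \<Rightarrow> real ^ 'n"
  assumes "\<And>k. loc_lip S (\<lambda>x. f x $ k)"
  shows "loc_lip S f"
proof -
  have sum: "loc_lip S (\<lambda>x. \<Sum>k\<in>A. f x $ k *\<^sub>R axis k (1::real))" for A :: "'n set"
  proof (induction A rule: infinite_finite_induct)
    case (insert k F)
    then show ?case
      using loc_lip_add[OF loc_lip_scaleR[OF assms loc_lip_const] insert.IH] by simp
  qed (simp_all add: loc_lip_const)
  have "f x = (\<Sum>k\<in>UNIV. f x $ k *\<^sub>R axis k 1)" for x
    using basis_expansion[of "f x"] by (simp add: scalar_mult_eq_scaleR)
  with sum[of UNIV] show ?thesis by simp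
qed

subsection \<open>The logarithmic mean\<close>

text \<open>The reciprocal of the logarithmic mean; the value at \<open>a = b\<close> is the
  continuous extension of the difference quotient.\<close>

definition ln_slope :: "real \<Rightarrow> real \<Rightarrow> real"
  where "ln_slope a b = (if a = b then 1 / a else (ln b - ln a) / (b - a))"

lemma segment_ge:
  fixes a b m t :: real
  assumes "m \<le> a" "m \<le> b" "0 \<le> t" "t \<le> 1"
  shows "m \<le> a + t * (b - a)"
proof -
  have "(1 - t) * m + t * m \<le> (1 - t) * a + t * b"
    using assms by (intro add_mono mult_left_mono) auto
  then show ?thesis by (simp add: algebra_simps)
qed

lemma ln_slope_has_integral:
  assumes "0 < a" "0 < b"
  shows "((\<lambda>t. 1 / (a + t * (b - a))) has_integral ln_slope a b) {0..1}"
proof (cases "a = b")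
  case True
  then show ?thesis
    using has_integral_const_real[of "1 / a" 0 1] by (simp add: ln_slope_def)
next
  case False
  have pos: "0 < a + t * (b - a)" if "t \<in> {0..1}" for t
    using segment_ge[of "min a b" a b t] assms that by auto
  have "((\<lambda>t. ln (a + t * (b - a)) / (b - a)) has_vector_derivative 1 / (a + t * (b - a)))
      (at t within {0..1})" if "t \<in> {0..1}" for t
    unfolding has_real_derivative_iff_has_vector_derivative[symmetric]
    using pos[OF that] False by (auto intro!: derivative_eq_intros)
  then have "((\<lambda>t. 1 / (a + t * (b - a))) has_integral
      (ln (a + 1 * (b - a)) / (b - a) - ln (a + 0 * (b - a)) / (b - a))) {0..1}"
    by (intro fundamental_theorem_of_calculus) auto
  then show ?thesis
    using False by (simp add: ln_slope_def diff_divide_distrib)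
qed

lemma ln_slope_pos:
  assumes "0 < a" "0 < b"
  shows "0 < ln_slope a b"
  using assms by (cases a b rule: linorder_cases)
    (auto simp: ln_slope_def zero_less_divide_iff)

text \<open>The integral representation avoids the removable singularity on the diagonal.\<close>

lemma loc_lip_ln_slope: "loc_lip ({0<..} \<times> {0<..}) (\<lambda>(a, b). ln_slope a b)"
proof (rule loc_lipI)
  fix z :: "real \<times> real" assume z: "z \<in> {0<..} \<times> {0<..}"
  \<comment> \<open>With half the smaller coordinate as radius, both coordinates stay at least
    \<open>m\<close> on the ball.\<close>
  define m where "m = min (fst z) (snd z) / 2"
  have m: "0 < m" using z by (auto simp: m_def)
  have "(2 / m\<^sup>2)-lipschitz_on (cball z m) (\<lambda>(a, b). ln_slope a b)"
  proof (rule lipschitz_onI)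
    fix p q assume pq: "p \<in> cball z m" "q \<in> cball z m"
    obtain a b c d where [simp]: "p = (a, b)" "q = (c, d)" by (cases p, cases q)
    have ge: "m \<le> fst r" "m \<le> snd r" if "r \<in> cball z m" for r
      using that dist_fst_le[of z r] dist_snd_le[of z r]
      by (auto simp: m_def dist_real_def abs_le_iff min_def split: if_splits)
    have abcd: "m \<le> a" "m \<le> b" "m \<le> c" "m \<le> d"
      using ge[OF pq(1)] ge[OF pq(2)] by auto
    have dist: "\<bar>a - c\<bar> \<le> dist p q" "\<bar>b - d\<bar> \<le> dist p q"
      using dist_fst_le[of p q] dist_snd_le[of p q] by (auto simp: dist_real_def)
    have I: "((\<lambda>t. 1 / (a + t * (b - a)) - 1 / (c + t * (d - c))) has_integral
        (ln_slope a b - ln_slope c d)) {0..1}"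
      using abcd m by (intro has_integral_diff ln_slope_has_integral) auto
    \<comment> \<open>A pointwise bound on the integrands suffices because the interval has length
      one. The factor 2 arises from bounding each coordinate difference by
      \<open>dist p q\<close>.\<close>
    have "norm (1 / (a + t * (b - a)) - 1 / (c + t * (d - c))) \<le> 2 / m\<^sup>2 * dist p q"
      if t: "t \<in> {0..1}" for t
    proof -
      have "(a + t * (b - a)) - (c + t * (d - c)) = (1 - t) * (a - c) + t * (b - d)"
        by (simp add: algebra_simps)
      also have "\<bar>\<dots>\<bar> \<le> \<bar>(1 - t) * (a - c)\<bar> + \<bar>t * (b - d)\<bar>" by (rule abs_triangle_ineq)
      also have "\<dots> \<le> 1 * dist p q + 1 * dist p q"
        unfolding abs_mult using t dist by (intro add_mono mult_mono) auto
      finally have "\<bar>(a + t * (b - a)) - (c + t * (d - c))\<bar> / m\<^sup>2 \<le> 2 * dist p q / m\<^sup>2"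
        by (intro divide_right_mono) auto
      moreover have "\<bar>1 / (a + t * (b - a)) - 1 / (c + t * (d - c))\<bar>
          \<le> \<bar>(a + t * (b - a)) - (c + t * (d - c))\<bar> / m\<^sup>2"
        using t m abcd by (intro abs_inverse_diff_le segment_ge) auto
      ultimately show ?thesis by simp
    qed
    from has_integral_bound_real[OF _ finite.emptyI I, of "2 / m\<^sup>2 * dist p q"] this
    show "dist (case p of (a, b) \<Rightarrow> ln_slope a b) (case q of (a, b) \<Rightarrow> ln_slope a b)
        \<le> 2 / m\<^sup>2 * dist p q"
      by (simp add: dist_real_def)
  qed simp
  then show "\<exists>r>0. \<exists>L. L-lipschitz_on (cball z r \<inter> {0<..} \<times> {0<..}) (\<lambda>(a, b). ln_slope a b)"
    using m by (meson Int_lower1 lipschitz_on_subset)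
qed

lemma log_mean_eq: "log_mean a um up = 1 / ln_slope (a um) (a up)"
  by (simp add: log_mean_def ln_slope_def jump_def)

lemma log_mean_pos: "0 < a um \<Longrightarrow> 0 < a up \<Longrightarrow> 0 < log_mean a um up"
  by (simp add: log_mean_eq ln_slope_pos)

text \<open>Besides positivity, this is the property of the logarithmic mean on which the entropy
  balance rests. For equal values both sides vanish.\<close>

lemma log_mean_times_jump_ln:
  assumes "0 < a um" "0 < a up"
  shows "log_mean a um up * (ln (a up) - ln (a um)) = a up - a um"
  using assms by (auto simp: log_mean_def jump_def)

lemma log_mean_same: "log_mean a u u = a u"
  by (simp add: log_mean_def)

subsection \<open>Columns\<close>

lemma vector_7:
  fixes a b c d e f g :: "'a::zero"
  defines "v \<equiv> vector [a, b, c, d, e, f, g] :: 'a ^ 7"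
  shows "v $ 1 = a" "v $ 2 = b" "v $ 3 = c" "v $ 4 = d" "v $ 5 = e" "v $ 6 = f" "v $ 7 = g"
  unfolding v_def vector_def by simp_all

lemma exhaust_7:
  fixes x :: 7
  shows "x = 1 \<or> x = 2 \<or> x = 3 \<or> x = 4 \<or> x = 5 \<or> x = 6 \<or> x = 7"
proof (induct x)
  case (of_int z)
  then have "z = 0 \<or> z = 1 \<or> z = 2 \<or> z = 3 \<or> z = 4 \<or> z = 5 \<or> z = 6" by fastforce
  then show ?case by auto
qed

lemma forall_7: "(\<forall>i::7. P i) \<longleftrightarrow> P 1 \<and> P 2 \<and> P 3 \<and> P 4 \<and> P 5 \<and> P 6 \<and> P 7"
  by (metis exhaust_7)

lemma loc_lip_pcol:
  assumes "\<And>i. loc_lip S (\<lambda>z. k z i)" "\<And>i. loc_lip S (\<lambda>z. a z i)" "\<And>i. loc_lip S (\<lambda>z. b z i)"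
    "\<And>i. loc_lip S (\<lambda>z. c z i)" "\<And>i. loc_lip S (\<lambda>z. d z i)"
  shows "loc_lip S (\<lambda>z. pcol (k z) (a z) (b z) (c z) (d z))"
proof (rule loc_lip_vec)
  have "\<forall>j. loc_lip S (\<lambda>z. pcol (k z) (a z) (b z) (c z) (d z) $ j)"
    unfolding forall_7 pcol_def vector_7 by (intro conjI loc_lip_mult assms)
  then show "loc_lip S (\<lambda>z. pcol (k z) (a z) (b z) (c z) (d z) $ j)" for j by simp
qed

text \<open>The linear part of \<open>alpha i\<close>, which is affine but not linear for phase
  2.\<close>

definition dalpha :: "2 \<Rightarrow> state \<Rightarrow> real"
  where "dalpha i D = (if i = 1 then D $ 1 else - D $ 1)"

lemma pcol_components:
  "alpha_rho i (pcol k a b c d) = k i * b i"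
  "alpha_rho_u i (pcol k a b c d) = k i * c i"
  "alpha_rho_E i (pcol k a b c d) = k i * d i"
  using exhaust_2[of i]
  by (auto simp: alpha_rho_def alpha_rho_u_def alpha_rho_E_def pcol_def vector_7)

text \<open>A column stores its first line for phase 1 only; the phase 2 entry can be recovered when
  it is the negative of the stored one, as for a prefactor proportional to the jump of
  \<open>alpha i\<close>.\<close>

lemma dalpha_pcol:
  assumes "k 2 * a 2 = - (k 1 * a 1)"
  shows "dalpha i (pcol k a b c d) = k i * a i"
  using exhaust_2[of i] assms by (auto simp: dalpha_def pcol_def vector_7)

lemma jump_alpha_2: "jump (alpha 2) um up = - jump (alpha 1) um up"
  by (simp add: jump_def alpha_def)

subsection \<open>The entropy variables\<close>

text \<open>The share of phase \<open>i\<close> in the derivative of \<open>eta\<close> in direction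
  \<open>D\<close>; the coefficients are the entropy variables. On the phase space
  \<open>gam M i * Cv M i\<close> is \<open>theta\<close> times the specific enthalpy.\<close>

definition entropy_pairing :: "bn_model \<Rightarrow> 2 \<Rightarrow> state \<Rightarrow> state \<Rightarrow> real"
  where "entropy_pairing M i u D =
    - (pressure M i u * theta M i u) * dalpha i D
    + (gam M i * Cv M i - spec_entropy M i u - theta M i u * (vel i u)\<^sup>2 / 2) * alpha_rho i D
    + theta M i u * vel i u * alpha_rho_u i D
    - theta M i u * alpha_rho_E i D"

lemma linear_phase:
  "bounded_linear (dalpha i)" "bounded_linear (alpha_rho i)"
  "bounded_linear (alpha_rho_u i)" "bounded_linear (alpha_rho_E i)"
  unfolding dalpha_def[abs_def] alpha_rho_def[abs_def] alpha_rho_u_def[abs_def] alpha_rho_E_def[abs_def]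
  by (cases "i = 1"; simp add: bounded_linear_vec_nth bounded_linear_minus)+

lemma linear_entropy_pairing: "linear (entropy_pairing M i u)"
  unfolding entropy_pairing_def
  by (intro linear_compose_add linear_compose_sub bounded_linear.linear
      bounded_linear_const_mult linear_phase)

lemmas entropy_pairing_linear =
  linear_add[OF linear_entropy_pairing] linear_diff[OF linear_entropy_pairing]

locale bn =
  fixes M :: bn_model
  assumes Cv_pos: "\<And>i. 0 < Cv M i"
    and chi_range: "0 \<le> chi M" "chi M \<le> 1"
begin

abbreviation "\<Omega> \<equiv> phase_space M"

lemma phaseD:
  assumes "u \<in> \<Omega>"
  shows "0 < alpha i u" "0 < rho i u" "0 < temp M i u" "0 < theta M i u" "0 < alpha_rho i u"
proof -
  show *: "0 < alpha i u" "0 < rho i u" and T: "0 < temp M i u"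
    using assms by (auto simp: phase_space_def)
  show "0 < theta M i u" using T by (simp add: theta_def)
  have "alpha_rho i u = alpha i u * rho i u" using * by (simp add: rho_def)
  then show "0 < alpha_rho i u" using * by simp
qed

text \<open>Multiplied by \<open>theta\<close>, the equations of state become linear in
  \<open>rho\<close> and \<open>theta\<close>, so the jump of \<open>p theta\<close> splits into
  jumps of these two quantities.\<close>

lemma pressure_theta:
  assumes "u \<in> \<Omega>"
  shows "pressure M i u * theta M i u = (gam M i - 1) * Cv M i * rho i u - pinf M i * theta M i u"
    and "rho i u * int_energy i u * theta M i u = Cv M i * rho i u + pinf M i * theta M i u"
proof -
  have "temp M i u * (rho i u * Cv M i) = rho i u * int_energy i u - pinf M i"
    using phaseD(2)[OF assms, of i] Cv_pos[of i] by (simp add: temp_def)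
  then have re: "rho i u * int_energy i u = temp M i u * (rho i u * Cv M i) + pinf M i" by simp
  have Tth: "temp M i u * theta M i u = 1"
    using phaseD(3)[OF assms, of i] by (simp add: theta_def)
  show 2: "rho i u * int_energy i u * theta M i u = Cv M i * rho i u + pinf M i * theta M i u"
    unfolding re using Tth by algebra
  show "pressure M i u * theta M i u = (gam M i - 1) * Cv M i * rho i u - pinf M i * theta M i u"
    unfolding pressure_def using 2 by algebra
qed

text \<open>The chain rule runs through density, velocity, energies and temperature. Multiplying by
  \<open>alpha rho\<close> clears the denominators of the quotient rule, and
  \<open>pressure_theta\<close> then matches the coefficients.\<close>

lemma entropy_phase_has_derivative:
  assumes u: "u \<in> \<Omega>"
  shows "((\<lambda>u. - (alpha i u * rho i u * spec_entropy M i u))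
    has_derivative entropy_pairing M i u) (at u)"
proof -
  note pos = phaseD[OF u, of i]
  have dA: "(alpha i has_derivative dalpha i) (at u)"
    unfolding alpha_def[abs_def] dalpha_def[abs_def]
    by (cases "i = 1") (auto intro!: derivative_eq_intros bounded_linear_imp_has_derivative
        bounded_linear_vec_nth)
  have dm: "(alpha_rho i has_derivative alpha_rho i) (at u)"
    and dw: "(alpha_rho_u i has_derivative alpha_rho_u i) (at u)"
    and dE: "(alpha_rho_E i has_derivative alpha_rho_E i) (at u)"
    using linear_phase by (auto intro: bounded_linear_imp_has_derivative)
  define r' where "r' D = (alpha_rho i D - rho i u * dalpha i D) / alpha i u" for D
  define v' where "v' D = (alpha_rho_u i D - vel i u * alpha_rho i D) / alpha_rho i u" for D
  define e' where "e' D = (alpha_rho_E i D - vel i u * alpha_rho_u i D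
      + ((vel i u)\<^sup>2 - tot_energy i u) * alpha_rho i D) / alpha_rho i u" for D
  define T' where "T' D = e' D / Cv M i + pinf M i * r' D / ((rho i u)\<^sup>2 * Cv M i)" for D
  have dr: "(rho i has_derivative r') (at u)"
    unfolding rho_def[abs_def] r'_def[abs_def] using pos
    by (auto intro!: derivative_eq_intros dA dm simp: field_simps)
  have dv: "(vel i has_derivative v') (at u)"
    unfolding vel_def[abs_def] v'_def[abs_def] using pos
    by (auto intro!: derivative_eq_intros dw dm simp: field_simps)
  have dt: "(tot_energy i has_derivative
      (\<lambda>D. (alpha_rho_E i D - tot_energy i u * alpha_rho i D) / alpha_rho i u)) (at u)"
    unfolding tot_energy_def[abs_def] using pos
    by (auto intro!: derivative_eq_intros dE dm simp: field_simps)
  have de: "(int_energy i has_derivative e') (at u)"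
    unfolding int_energy_def[abs_def] e'_def[abs_def]
    using pos
    by (auto intro!: derivative_eq_intros dt dv simp: v'_def field_simps power2_eq_square)
  have dT: "(temp M i has_derivative T') (at u)"
    unfolding temp_def[abs_def] T'_def[abs_def]
    using pos Cv_pos[of i]
    by (auto intro!: derivative_eq_intros dr de simp: field_simps power2_eq_square)
  \<comment> \<open>Since ln(1/T) = -ln T, the derivative of \<open>temp\<close> can be used
    directly.\<close>
  have s: "spec_entropy M i = (\<lambda>u. Cv M i * (ln (temp M i u) - (gam M i - 1) * ln (rho i u)))"
    by (simp add: spec_entropy_def theta_def fun_eq_iff ln_div algebra_simps)
  have ds: "(spec_entropy M i has_derivative
      (\<lambda>D. Cv M i * (T' D * theta M i u - (gam M i - 1) * (r' D / rho i u)))) (at u)"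
    unfolding s using pos
    by (auto intro!: derivative_eq_intros dr dT simp: theta_def field_simps)
  have "((\<lambda>u. - (alpha i u * rho i u * spec_entropy M i u)) has_derivative
     (\<lambda>D. - ((alpha i u * rho i u) * (Cv M i * (T' D * theta M i u - (gam M i - 1) * (r' D / rho i u)))
        + (alpha i u * r' D + dalpha i D * rho i u) * spec_entropy M i u))) (at u)"
    by (auto intro!: derivative_eq_intros dA dr ds)
  also have "(\<lambda>D. - ((alpha i u * rho i u) * (Cv M i * (T' D * theta M i u - (gam M i - 1) * (r' D / rho i u)))
        + (alpha i u * r' D + dalpha i D * rho i u) * spec_entropy M i u)) = entropy_pairing M i u"
  proof
    fix D
    have m: "alpha i u * rho i u = alpha_rho i u" using pos by (simp add: rho_def)
    have ar: "alpha i u * r' D = alpha_rho i D - rho i u * dalpha i D"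
      using pos by (simp add: r'_def)
    have me: "alpha_rho i u * e' D = alpha_rho_E i D - vel i u * alpha_rho_u i D
      + ((vel i u)\<^sup>2 - tot_energy i u) * alpha_rho i D"
      using pos by (simp add: e'_def)
    have CT: "alpha i u * rho i u * (Cv M i * T' D)
        = alpha_rho i u * e' D + pinf M i * (alpha i u * r' D) / rho i u"
      using pos Cv_pos[of i] unfolding m[symmetric]
      by (simp add: T'_def field_simps power2_eq_square)
    define x where "x = alpha_rho i D / rho i u"
    have x: "alpha_rho i D = x * rho i u" using pos by (simp add: x_def)
    have CT2: "alpha i u * rho i u * (Cv M i * T' D)
        = alpha_rho_E i D - vel i u * alpha_rho_u i D
          + ((vel i u)\<^sup>2 - tot_energy i u) * alpha_rho i D + pinf M i * (x - dalpha i D)"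
      unfolding CT me ar using pos by (simp add: x_def field_simps)
    have Cr: "alpha i u * rho i u * (r' D / rho i u) = x * rho i u - rho i u * dalpha i D"
      using ar x pos by simp
    have tot: "tot_energy i u = int_energy i u + (vel i u)\<^sup>2 / 2" by (simp add: int_energy_def)
    define y where "y = r' D / rho i u"
    show "- ((alpha i u * rho i u) * (Cv M i * (T' D * theta M i u - (gam M i - 1) * (r' D / rho i u)))
        + (alpha i u * r' D + dalpha i D * rho i u) * spec_entropy M i u) = entropy_pairing M i u D"
    proof -
      have "(alpha i u * rho i u) * (Cv M i * (T' D * theta M i u - (gam M i - 1) * (r' D / rho i u)))
        = theta M i u * (alpha i u * rho i u * (Cv M i * T' D))
          - Cv M i * (gam M i - 1) * (alpha i u * rho i u * (r' D / rho i u))"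
        unfolding y_def[symmetric] by (simp add: algebra_simps)
      also have "\<dots> = theta M i u * (alpha_rho_E i D - vel i u * alpha_rho_u i D
          + ((vel i u)\<^sup>2 - tot_energy i u) * alpha_rho i D + pinf M i * (x - dalpha i D))
          - Cv M i * (gam M i - 1) * (x * rho i u - rho i u * dalpha i D)"
        unfolding CT2 Cr ..
      finally show ?thesis
        unfolding ar entropy_pairing_def pressure_theta(1)[OF u] tot x
        using pressure_theta(2)[OF u, of i]
        by (simp add: algebra_simps)
    qed
  qed
  finally show ?thesis .
qed

lemma eta_has_derivative:
  assumes "u \<in> \<Omega>"
  shows "(eta M has_derivative (\<lambda>D. \<Sum>i\<in>UNIV. entropy_pairing M i u D)) (at u)"
proof -
  have "eta M = (\<lambda>u. \<Sum>i\<in>UNIV. - (alpha i u * rho i u * spec_entropy M i u))"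
    by (simp add: eta_def fun_eq_iff sum_negf)
  then show ?thesis
    using has_derivative_sum[of UNIV, OF entropy_phase_has_derivative[OF assms]] by simp
qed

text \<open>The gradient tested with \<open>D\<close> is the derivative at \<open>D\<close>, so
  every later pairing can be computed phase by phase without coordinates.\<close>

lemma entropy_vars_inner:
  assumes "u \<in> \<Omega>"
  shows "entropy_vars (eta M) u \<bullet> D = (\<Sum>i\<in>UNIV. entropy_pairing M i u D)"
proof -
  let ?F = "\<lambda>D. \<Sum>i\<in>UNIV. entropy_pairing M i u D"
  have F: "frechet_derivative (eta M) (at u) = ?F"
    using frechet_derivative_at[OF eta_has_derivative[OF assms]] by simp
  have lin: "linear ?F" by (intro linear_compose_sum ballI linear_entropy_pairing)
  have "?F D = ?F (\<Sum>k\<in>UNIV. D $ k *\<^sub>R axis k 1)"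
    using basis_expansion[of D] by (simp add: scalar_mult_eq_scaleR)
  also have "\<dots> = (\<Sum>k\<in>UNIV. D $ k *\<^sub>R ?F (axis k 1))"
    by (simp only: linear_sum[OF lin] linear_cmul[OF lin])
  finally show ?thesis
    by (simp add: entropy_vars_def inner_vec_def F mult.commute)
qed

subsection \<open>Entropy balance\<close>

text \<open>The second term is the share of phase \<open>i\<close> in the entropy flux; the first is
  the entropy potential, whose jump the numerical flux has to reproduce.\<close>

lemma pairing_flux:
  assumes "u \<in> \<Omega>"
  shows "entropy_pairing M i u (flux M u)
    = alpha i u * vel i u * (pressure M i u * theta M i u)
      - alpha i u * rho i u * vel i u * spec_entropy M i u"
proof -
  have tot: "tot_energy i u = int_energy i u + (vel i u)\<^sup>2 / 2" by (simp add: int_energy_def)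
  have "entropy_pairing M i u (flux M u) =
     (gam M i * Cv M i - spec_entropy M i u - theta M i u * (vel i u)\<^sup>2 / 2)
        * (alpha i u * rho i u * vel i u)
    + theta M i u * vel i u * (alpha i u * (rho i u * (vel i u)\<^sup>2 + pressure M i u))
    - theta M i u * (alpha i u * vel i u * (rho i u * tot_energy i u + pressure M i u))"
    by (simp add: entropy_pairing_def flux_def pcol_components dalpha_pcol)
  then show ?thesis
    unfolding tot using pressure_theta[OF assms, of i] by algebra
qed

section \<open>Interface velocity and pressure\<close>

lemma beta_range:
  assumes "u \<in> \<Omega>"
  shows "0 \<le> beta M u" "beta M u \<le> 1"
    "0 < chi M * alpha_rho 1 u + (1 - chi M) * alpha_rho 2 u"
proof -
  note m = phaseD(5)[OF assms]
  show pos: "0 < chi M * alpha_rho 1 u + (1 - chi M) * alpha_rho 2 u"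
    using m[of 1] m[of 2] chi_range
    by (cases "chi M = 0") (auto intro: add_pos_nonneg)
  show "0 \<le> beta M u" "beta M u \<le> 1"
    using pos m[of 1] m[of 2] chi_range by (auto simp: beta_def divide_le_eq)
qed

lemma mu_denominator_pos:
  assumes "u \<in> \<Omega>"
  shows "0 < beta M u * temp M 1 u + (1 - beta M u) * temp M 2 u"
  using phaseD(3)[OF assms, of 1] phaseD(3)[OF assms, of 2] beta_range(1,2)[OF assms]
  by (cases "beta M u = 0") (simp_all add: add_pos_nonneg)

text \<open>This identity is what the interface closure is designed for: it makes the interfacial
  entropy production of the two phases cancel.\<close>

lemma interface_closure:
  assumes "u \<in> \<Omega>"
  shows "(1 - mu M u) * (1 - beta M u) * theta M 1 u = mu M u * beta M u * theta M 2 u"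
proof -
  \<comment> \<open>Both sides of the claim equal \<open>beta * (1 - beta) / N\<close>: the
    temperatures in the weights cancel the factors \<open>theta\<close>.\<close>
  define N where "N = beta M u * temp M 1 u + (1 - beta M u) * temp M 2 u"
  have N: "0 < N" using mu_denominator_pos[OF assms] by (simp add: N_def)
  have mu: "mu M u = (1 - beta M u) * temp M 2 u / N" by (simp only: mu_def N_def)
  have "1 - mu M u = (N - (1 - beta M u) * temp M 2 u) / N"
    using N by (simp add: mu diff_divide_distrib)
  also have "\<dots> = beta M u * temp M 1 u / N" by (simp add: N_def)
  finally have a: "(1 - mu M u) * theta M 1 u = beta M u / N"
    using phaseD(3)[OF assms, of 1] by (simp add: theta_def)
  have b: "mu M u * theta M 2 u = (1 - beta M u) / N"
    using phaseD(3)[OF assms, of 2] by (simp add: mu theta_def)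
  have "(1 - mu M u) * (1 - beta M u) * theta M 1 u = beta M u / N * (1 - beta M u)"
    unfolding a[symmetric] by (simp only: mult_ac)
  also have "\<dots> = mu M u * theta M 2 u * beta M u" unfolding b by simp
  finally show ?thesis by (simp only: mult_ac)
qed

lemma pairing_d_col:
  assumes "w \<in> \<Omega>"
  shows "(\<Sum>i\<in>UNIV. entropy_pairing M i w (d_col M w um up))
    = - (\<Sum>i\<in>UNIV. jump (alpha i) um up / 2 * (vel i w * (pressure M i w * theta M i w)))"
proof -
  have pair: "entropy_pairing M i w (d_col M w um up) = jump (alpha i) um up / 2 *
     ((p_I M w - pressure M i w) * (u_I M w - vel i w) * theta M i w
       - vel i w * (pressure M i w * theta M i w))" for i
    by (simp add: entropy_pairing_def d_col_def pcol_components dalpha_pcol jump_alpha_2)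
       (simp add: algebra_simps)
  \<comment> \<open>For phase 1 the differences are \<open>(1 - mu) * (p2 - p1)\<close> and
    \<open>(1 - beta) * (u2 - u1)\<close>, for phase 2 they are \<open>mu * (p1 - p2)\<close> and
    \<open>beta * (u1 - u2)\<close>. Hence the equality is \<open>interface_closure\<close> times
    \<open>(p2 - p1) * (u2 - u1)\<close>.\<close>
  have cancel: "(p_I M w - pressure M 1 w) * (u_I M w - vel 1 w) * theta M 1 w
      = (p_I M w - pressure M 2 w) * (u_I M w - vel 2 w) * theta M 2 w"
    using interface_closure[OF assms] unfolding p_I_def u_I_def by algebra
  show ?thesis
    unfolding sum_2 pair jump_alpha_2 cancel by (simp add: field_simps)
qed

text \<open>This says that the column multiplied by \<open>bs\<close> is orthogonal to the jump of
  the entropy variables: the missing first entry of the pairing is the jump of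
  \<open>p theta\<close> on the right. The same combination recurs, times the mean velocity, in the
  main part of \<open>h_flux\<close>.\<close>

lemma pairing_stabilisation:
  fixes i um up
  defines "r \<equiv> log_mean (rho i) um up"
  defines "w \<equiv> \<lambda>u. gam M i * Cv M i - spec_entropy M i u - theta M i u * (vel i u)\<^sup>2 / 2"
  assumes um: "um \<in> \<Omega>" and up: "up \<in> \<Omega>"
  shows "r * (w up - w um)
      + r * mean (vel i) um up * (theta M i up * vel i up - theta M i um * vel i um)
      - (energy_mean M i um up + pinf M i) * (theta M i up - theta M i um)
    = pressure M i up * theta M i up - pressure M i um * theta M i um"
proof -
  define q where "q = log_mean (theta M i) um up"
  have q: "0 < q" using phaseD(4) um up by (simp add: q_def log_mean_pos)
  have lr: "r * (ln (rho i up) - ln (rho i um)) = rho i up - rho i um"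
    unfolding r_def using phaseD(2) um up by (simp add: log_mean_times_jump_ln)
  have "q * (ln (theta M i up) - ln (theta M i um)) = theta M i up - theta M i um"
    unfolding q_def using phaseD(4) um up by (simp add: log_mean_times_jump_ln)
  then have lq: "ln (theta M i up) - ln (theta M i um) = (theta M i up - theta M i um) / q"
    using q by (simp add: field_simps)
  \<comment> \<open>A discrete version of
    \<open>rho ds = - Cv (rho dtheta / theta + (gam - 1) drho)\<close>, exact thanks to the two
    logarithmic means.\<close>
  have s: "r * (spec_entropy M i um - spec_entropy M i up)
      = r * (Cv M i / q) * (theta M i up - theta M i um)
        + (gam M i - 1) * Cv M i * (rho i up - rho i um)"
  proof -
    have "r * (spec_entropy M i um - spec_entropy M i up)
      = r * Cv M i * (ln (theta M i up) - ln (theta M i um))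
        + (gam M i - 1) * Cv M i * (r * (ln (rho i up) - ln (rho i um)))"
      by (simp add: spec_entropy_def algebra_simps)
    then show ?thesis unfolding lr lq by simp
  qed
  \<comment> \<open>The kinetic terms cancel since the mean velocity times the jump of
    \<open>theta u\<close> is half the jump of \<open>theta u^2\<close> plus
    \<open>u- u+ / 2\<close> times the jump of \<open>theta\<close>; this explains the product of
    velocities in \<open>energy_mean\<close>.\<close>
  show ?thesis
    unfolding pressure_theta[OF um] pressure_theta[OF up] w_def mean_def energy_mean_def
      q_def[symmetric] r_def[symmetric]
    using s by (simp add: field_simps power2_eq_square) algebra
qed

lemma pairing_h_flux:
  assumes um: "um \<in> \<Omega>" and up: "up \<in> \<Omega>"
  shows "entropy_pairing M i up (h_flux M bs um up) - entropy_pairing M i um (h_flux M bs um up)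
    = mean (alpha i) um up * (vel i up * (pressure M i up * theta M i up)
        - vel i um * (pressure M i um * theta M i um))"
proof -
  define r where "r = log_mean (rho i) um up"
  define w where "w u = gam M i * Cv M i - spec_entropy M i u - theta M i u * (vel i u)\<^sup>2 / 2" for u
  define v where "v = mean (vel i) um up"
  define e where "e = energy_mean M i um up + pinf M i"
  define P where "P = p_theta_ratio M i um up"
  have P: "P * mean (theta M i) um up = mean (\<lambda>u. pressure M i u * theta M i u) um up"
  proof -
    have "0 < mean (theta M i) um up"
      using phaseD(4)[OF um, of i] phaseD(4)[OF up, of i] by (simp add: mean_def)
    then show ?thesis by (simp add: P_def p_theta_ratio_def)
  qed
  have pair: "entropy_pairing M i u (h_flux M bs um up) =
      w u * (mean (alpha i) um up * v * r)
      + theta M i u * vel i u * (mean (alpha i) um up * (v\<^sup>2 * r + P))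
      - theta M i u * (mean (alpha i) um up * v * (e + P))
      - bs um up * (jump (alpha i) um up / 2) *
        (- (pressure M i u * theta M i u) + w u * r + theta M i u * vel i u * (r * v)
         - theta M i u * e)" for u
  proof -
    have lin: "entropy_pairing M i u (x - c *\<^sub>R y)
        = entropy_pairing M i u x - c * entropy_pairing M i u y" for x y c
      by (simp add: entropy_pairing_linear linear_cmul[OF linear_entropy_pairing])
    show ?thesis
      unfolding h_flux_def lin
      by (simp add: entropy_pairing_def pcol_components dalpha_pcol jump_alpha_2
          r_def w_def v_def e_def P_def)
         (simp add: field_simps)
  qed
  have st: "r * (w up - w um) + r * v * (theta M i up * vel i up - theta M i um * vel i um)
      - e * (theta M i up - theta M i um)
    = pressure M i up * theta M i up - pressure M i um * theta M i um"
    unfolding r_def w_def v_def e_def by (rule pairing_stabilisation[OF um up])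
  \<comment> \<open>Grouped so that \<open>st\<close> applies twice: the bracket after
    \<open>bs\<close> vanishes whatever the value of \<open>bs\<close>, and the main part keeps the
    jump of \<open>p theta\<close>.\<close>
  have "entropy_pairing M i up (h_flux M bs um up) - entropy_pairing M i um (h_flux M bs um up)
    = mean (alpha i) um up * (v * (r * (w up - w um)
          + r * v * (theta M i up * vel i up - theta M i um * vel i um)
          - e * (theta M i up - theta M i um))
        + P * (theta M i up * vel i up - theta M i um * vel i um - v * (theta M i up - theta M i um)))
      - bs um up * (jump (alpha i) um up / 2) *
        ((r * (w up - w um) + r * v * (theta M i up * vel i up - theta M i um * vel i um)
          - e * (theta M i up - theta M i um))
         - (pressure M i up * theta M i up - pressure M i um * theta M i um))"
    unfolding pair by (simp add: algebra_simps power2_eq_square)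
  also have "\<dots> = mean (alpha i) um up *
      (v * (pressure M i up * theta M i up - pressure M i um * theta M i um)
       + P * (theta M i up * vel i up - theta M i um * vel i um - v * (theta M i up - theta M i um)))"
    unfolding st by simp
  \<comment> \<open>The product rule for jumps leaves the mean of \<open>theta\<close> times the
    velocity jump, and that mean cancels the denominator of \<open>P\<close>.\<close>
  also have "P * (theta M i up * vel i up - theta M i um * vel i um - v * (theta M i up - theta M i um))
      = P * mean (theta M i) um up * (vel i up - vel i um)"
    by (simp add: v_def mean_def field_simps)
  finally show ?thesis
    unfolding P by (simp add: v_def mean_def field_simps)
qed

lemma entropy_balance_fluxes:
  "entropy_balance \<Omega> (eta M) (entropy_flux M)
    (fluct_minus (flux M) (h_flux M bs) (d_minus M)) (fluct_plus (flux M) (h_flux M bs) (d_plus M))"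
  unfolding entropy_balance_def
proof (intro ballI)
  fix um up assume um: "um \<in> \<Omega>" and up: "up \<in> \<Omega>"
  let ?h = "h_flux M bs um up"
  let ?z = "\<lambda>i u. vel i u * (pressure M i u * theta M i u)"
  have "entropy_vars (eta M) um \<bullet> fluct_minus (flux M) (h_flux M bs) (d_minus M) um up
      + entropy_vars (eta M) up \<bullet> fluct_plus (flux M) (h_flux M bs) (d_plus M) um up
    = (\<Sum>i\<in>UNIV. entropy_pairing M i up (flux M up) - entropy_pairing M i um (flux M um)
          - (entropy_pairing M i up ?h - entropy_pairing M i um ?h))
      + (\<Sum>i\<in>UNIV. entropy_pairing M i um (d_col M um um up))
      + (\<Sum>i\<in>UNIV. entropy_pairing M i up (d_col M up um up))"
    unfolding entropy_vars_inner[OF um] entropy_vars_inner[OF up]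
      fluct_minus_def fluct_plus_def d_minus_def d_plus_def entropy_pairing_linear
    by (simp add: sum.distrib sum_subtractf)
  also have "\<dots> = (\<Sum>i\<in>UNIV. alpha i up * ?z i up - alpha i up * rho i up * vel i up * spec_entropy M i up
        - (alpha i um * ?z i um - alpha i um * rho i um * vel i um * spec_entropy M i um)
        - mean (alpha i) um up * (?z i up - ?z i um))
      - (\<Sum>i\<in>UNIV. jump (alpha i) um up / 2 * ?z i um)
      - (\<Sum>i\<in>UNIV. jump (alpha i) um up / 2 * ?z i up)"
    unfolding pairing_flux[OF um] pairing_flux[OF up] pairing_h_flux[OF um up]
      pairing_d_col[OF um] pairing_d_col[OF up]
    by (simp add: mult.assoc)
  \<comment> \<open>The jump of \<open>alpha z\<close> is mean \<open>alpha\<close> times jump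
    \<open>z\<close> plus jump \<open>alpha\<close> times mean \<open>z\<close>; the last two sums
    supply the second part, so only the entropy flux remains.\<close>
  also have "\<dots> = entropy_flux M up - entropy_flux M um"
    by (simp add: entropy_flux_def sum_2 mean_def jump_def field_simps)
  finally show "entropy_vars (eta M) um \<bullet> fluct_minus (flux M) (h_flux M bs) (d_minus M) um up
      + entropy_vars (eta M) up \<bullet> fluct_plus (flux M) (h_flux M bs) (d_plus M) um up
    = entropy_flux M up - entropy_flux M um" .
qed

subsection \<open>Consistency\<close>

lemma h_flux_same:
  assumes "u \<in> \<Omega>"
  shows "h_flux M bs u u = flux M u"
proof -
  have P: "p_theta_ratio M i u u = pressure M i u" for i
    using phaseD(4)[OF assms, of i] by (simp add: p_theta_ratio_def mean_def)
  have E: "energy_mean M i u u + pressure M i u + pinf M i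
      = rho i u * tot_energy i u + pressure M i u" for i
  proof -
    \<comment> \<open>This is the defining relation of the temperature; the summand
      \<open>pinf\<close> in the energy flux restores the full internal energy.\<close>
    have "rho i u * (Cv M i / theta M i u) = rho i u * int_energy i u - pinf M i"
      using pressure_theta(2)[OF assms, of i] phaseD(4)[OF assms, of i]
      by (simp add: field_simps)
    then show ?thesis
      by (simp add: energy_mean_def log_mean_same int_energy_def algebra_simps power2_eq_square)
  qed
  show ?thesis
    unfolding h_flux_def flux_def P E
    by (simp add: vec_eq_iff forall_7 pcol_def vector_7 jump_def mean_def log_mean_same algebra_simps)
qed

lemma consistent_fluxes: "consistent \<Omega> (flux M) (h_flux M bs) (d_minus M) (d_plus M)"
  by (simp add: consistent_def h_flux_same d_minus_def d_plus_def d_col_def jump_def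
      pcol_def vec_eq_iff forall_7 vector_7)

subsection \<open>Lipschitz continuity of the fluxes\<close>

lemma loc_lip_basic:
  "loc_lip \<Omega> (alpha i)" "loc_lip \<Omega> (alpha_rho i)" "loc_lip \<Omega> (alpha_rho_u i)"
  "loc_lip \<Omega> (alpha_rho_E i)"
proof -
  have "loc_lip \<Omega> (\<lambda>u. u $ 1)" by (intro bounded_linear.loc_lip bounded_linear_vec_nth)
  then show "loc_lip \<Omega> (alpha i)"
    unfolding alpha_def[abs_def] by (cases "i = 1") (auto intro: loc_lip_const loc_lip_diff)
qed (intro bounded_linear.loc_lip linear_phase)+

lemma loc_lip_rho: "loc_lip \<Omega> (rho i)"
  unfolding rho_def[abs_def] by (intro loc_lip_divide loc_lip_basic phaseD)

lemma loc_lip_vel: "loc_lip \<Omega> (vel i)"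
  unfolding vel_def[abs_def] by (intro loc_lip_divide loc_lip_basic phaseD)

lemma loc_lip_tot_energy: "loc_lip \<Omega> (tot_energy i)"
  unfolding tot_energy_def[abs_def] by (intro loc_lip_divide loc_lip_basic phaseD)

lemma loc_lip_int_energy: "loc_lip \<Omega> (int_energy i)"
  unfolding int_energy_def[abs_def]
  by (intro loc_lip_diff loc_lip_divide_const loc_lip_power2 loc_lip_tot_energy loc_lip_vel)

lemma loc_lip_pressure: "loc_lip \<Omega> (pressure M i)"
  unfolding pressure_def[abs_def]
  by (intro loc_lip_diff loc_lip_mult loc_lip_const loc_lip_rho loc_lip_int_energy)

lemma loc_lip_temp: "loc_lip \<Omega> (temp M i)"
  unfolding temp_def[abs_def]
  by (intro loc_lip_divide loc_lip_diff loc_lip_mult loc_lip_const loc_lip_rho loc_lip_int_energy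
      mult_pos_pos phaseD Cv_pos)

lemma loc_lip_theta: "loc_lip \<Omega> (theta M i)"
  unfolding theta_def[abs_def] by (intro loc_lip_divide loc_lip_const loc_lip_temp phaseD)

lemma loc_lip_beta: "loc_lip \<Omega> (beta M)"
  unfolding beta_def[abs_def]
  by (intro loc_lip_divide loc_lip_add loc_lip_mult loc_lip_const loc_lip_basic beta_range)

lemma loc_lip_mu: "loc_lip \<Omega> (mu M)"
  unfolding mu_def[abs_def]
  by (intro loc_lip_divide loc_lip_add loc_lip_diff loc_lip_mult loc_lip_const loc_lip_beta
      loc_lip_temp mu_denominator_pos)

lemma loc_lip_u_I: "loc_lip \<Omega> (u_I M)"
  unfolding u_I_def[abs_def]
  by (intro loc_lip_add loc_lip_diff loc_lip_mult loc_lip_const loc_lip_beta loc_lip_vel)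

lemma loc_lip_p_I: "loc_lip \<Omega> (p_I M)"
  unfolding p_I_def[abs_def]
  by (intro loc_lip_add loc_lip_diff loc_lip_mult loc_lip_const loc_lip_mu loc_lip_pressure)

lemma loc_lip_flux: "loc_lip \<Omega> (flux M)"
  unfolding flux_def[abs_def]
  by (intro loc_lip_pcol loc_lip_add loc_lip_mult loc_lip_power2 loc_lip_const loc_lip_basic
      loc_lip_rho loc_lip_vel loc_lip_pressure loc_lip_tot_energy)

lemma loc_lip_fst: "loc_lip \<Omega> f \<Longrightarrow> loc_lip (\<Omega> \<times> \<Omega>) (\<lambda>z. f (fst z))"
  by (rule loc_lip_compose[OF bounded_linear.loc_lip[OF bounded_linear_fst]]) auto

lemma loc_lip_snd: "loc_lip \<Omega> f \<Longrightarrow> loc_lip (\<Omega> \<times> \<Omega>) (\<lambda>z. f (snd z))"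
  by (rule loc_lip_compose[OF bounded_linear.loc_lip[OF bounded_linear_snd]]) auto

lemma loc_lip_mean: "loc_lip \<Omega> a \<Longrightarrow> loc_lip (\<Omega> \<times> \<Omega>) (\<lambda>z. mean a (fst z) (snd z))"
  unfolding mean_def by (intro loc_lip_divide_const loc_lip_add loc_lip_fst loc_lip_snd)

lemma loc_lip_jump: "loc_lip \<Omega> a \<Longrightarrow> loc_lip (\<Omega> \<times> \<Omega>) (\<lambda>z. jump a (fst z) (snd z))"
  unfolding jump_def by (intro loc_lip_diff loc_lip_fst loc_lip_snd)

text \<open>As the reciprocal of the positive, locally Lipschitz \<open>ln_slope\<close>, the
  logarithmic mean needs no case distinction at equal values.\<close>

lemma loc_lip_log_mean:
  assumes a: "loc_lip \<Omega> a" and pos: "\<And>u. u \<in> \<Omega> \<Longrightarrow> 0 < a u"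
  shows "loc_lip (\<Omega> \<times> \<Omega>) (\<lambda>z. log_mean a (fst z) (snd z))"
proof -
  have "loc_lip (\<Omega> \<times> \<Omega>) (\<lambda>z. ln_slope (a (fst z)) (a (snd z)))"
    using loc_lip_compose[OF loc_lip_Pair[OF loc_lip_fst[OF a] loc_lip_snd[OF a]] loc_lip_ln_slope] pos
    by auto
  then show ?thesis
    unfolding log_mean_eq using pos by (intro loc_lip_divide loc_lip_const ln_slope_pos) auto
qed

lemma loc_lip_p_theta_ratio: "loc_lip (\<Omega> \<times> \<Omega>) (\<lambda>z. p_theta_ratio M i (fst z) (snd z))"
  unfolding p_theta_ratio_def
  by (intro loc_lip_divide loc_lip_mean loc_lip_mult loc_lip_pressure loc_lip_theta)
     (auto simp: mean_def intro!: add_pos_pos phaseD)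

lemma loc_lip_energy_mean: "loc_lip (\<Omega> \<times> \<Omega>) (\<lambda>z. energy_mean M i (fst z) (snd z))"
  unfolding energy_mean_def
  by (intro loc_lip_mult loc_lip_add loc_lip_divide loc_lip_divide_const loc_lip_const
      loc_lip_log_mean loc_lip_fst loc_lip_snd loc_lip_rho loc_lip_theta loc_lip_vel phaseD)
     (auto intro!: log_mean_pos phaseD)

lemma loc_lip_h_flux:
  assumes "loc_lip (\<Omega> \<times> \<Omega>) (\<lambda>z. bs (fst z) (snd z))"
  shows "loc_lip (\<Omega> \<times> \<Omega>) (\<lambda>z. h_flux M bs (fst z) (snd z))"
  unfolding h_flux_def
  by (intro loc_lip_diff loc_lip_scaleR assms loc_lip_pcol loc_lip_add loc_lip_mult loc_lip_power2
      loc_lip_divide_const loc_lip_const loc_lip_mean loc_lip_jump loc_lip_log_mean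
      loc_lip_basic loc_lip_rho loc_lip_vel loc_lip_p_theta_ratio loc_lip_energy_mean phaseD)

lemma loc_lip_d_col:
  "loc_lip (\<Omega> \<times> \<Omega>) (\<lambda>z. d_col M (fst z) (fst z) (snd z))"
  "loc_lip (\<Omega> \<times> \<Omega>) (\<lambda>z. d_col M (snd z) (fst z) (snd z))"
  unfolding d_col_def
  by (intro loc_lip_pcol loc_lip_mult loc_lip_minus loc_lip_divide_const loc_lip_const loc_lip_jump
      loc_lip_basic loc_lip_fst loc_lip_snd loc_lip_u_I loc_lip_p_I)+

lemma lipschitz_pair_iff: "lipschitz_pair S g \<longleftrightarrow> loc_lip (S \<times> S) (\<lambda>z. g (fst z) (snd z))"
  by (simp add: lipschitz_pair_def loc_lip_def case_prod_unfold)

text \<open>Since \<open>bs\<close> is an arbitrary function of both states multiplying a column of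
  \<open>h_flux\<close>, its regularity is passed on to the fluctuations.\<close>

lemma lipschitz_fluctuations:
  assumes "lipschitz_pair \<Omega> bs"
  shows "lipschitz_pair \<Omega> (fluct_minus (flux M) (h_flux M bs) (d_minus M))"
    and "lipschitz_pair \<Omega> (fluct_plus (flux M) (h_flux M bs) (d_plus M))"
  unfolding lipschitz_pair_iff fluct_minus_def fluct_plus_def d_minus_def d_plus_def
  by (intro loc_lip_add loc_lip_diff loc_lip_h_flux loc_lip_d_col assms[unfolded lipschitz_pair_iff]
      loc_lip_fst[OF loc_lip_flux] loc_lip_snd[OF loc_lip_flux])+

end

section \<open>The nonconservative product in matrix form\<close>

lemma d_col_eq_matrix: "d_col M w um up = ((1/2) *\<^sub>R nc_matrix M w) *v (up - um)"
proof -
  have mv: "(((1/2) *\<^sub>R nc_matrix M w) *v (up - um)) $ k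
      = (1/2) * nc_matrix M w $ k $ 1 * (up - um) $ 1" for k
  proof -
    have "(((1/2) *\<^sub>R nc_matrix M w) *v (up - um)) $ k
        = (\<Sum>l\<in>(UNIV :: 7 set). if l = 1 then (1/2) * nc_matrix M w $ k $ 1 * (up - um) $ 1 else 0)"
      unfolding matrix_vector_mult_def vec_lambda_beta
      by (rule sum.cong) (auto simp: nc_matrix_def)
    then show ?thesis by simp
  qed
  show ?thesis
    unfolding vec_eq_iff mv forall_7
    by (simp add: d_col_def nc_matrix_def pcol_def vector_7 jump_def alpha_def field_simps)
qed

theorem proposition4p1:
  fixes M :: bn_model and bs :: "state \<Rightarrow> state \<Rightarrow> real"
  assumes "\<And>i. 0 < Cv M i"
    and "\<And>i. 1 < gam M i"
    and "\<And>i. 0 \<le> pinf M i"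
    and "chi M \<in> {0, 1/2, 1}"
    and "\<And>um up. um \<in> phase_space M \<Longrightarrow> up \<in> phase_space M \<Longrightarrow> 0 \<le> bs um up"
  shows "consistent (phase_space M) (flux M) (h_flux M bs) (d_minus M) (d_plus M)
    \<and> entropy_balance (phase_space M) (eta M) (entropy_flux M)
        (fluct_minus (flux M) (h_flux M bs) (d_minus M))
        (fluct_plus (flux M) (h_flux M bs) (d_plus M))
    \<and> (lipschitz_pair (phase_space M) bs \<longrightarrow>
        entropy_conservative (phase_space M) (eta M) (entropy_flux M)
          (flux M) (h_flux M bs) (d_minus M) (d_plus M))
    \<and> (\<exists>Cm Cp :: state \<Rightarrow> state \<Rightarrow> real ^ 7 ^ 7.
        (\<forall>um\<in>phase_space M. \<forall>up\<in>phase_space M.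
           d_minus M um up = Cm um up *v (up - um)
           \<and> d_plus M um up = Cp um up *v (up - um)
           \<and> (Cp um up + Cm um up) + (Cp up um + Cm up um) = nc_matrix M um + nc_matrix M up)
        \<and> (\<forall>u\<in>phase_space M. Cp u u + Cm u u = nc_matrix M u))"
proof -
  interpret bn M
    using assms(1,4) by unfold_locales auto
  \<comment> \<open>The sum of these witnesses is the average of \<open>nc_matrix\<close> at the two
    states, hence symmetric in them; both matrix identities follow.\<close>
  let ?Cm = "\<lambda>um up. (1/2) *\<^sub>R nc_matrix M um" and ?Cp = "\<lambda>um up. (1/2) *\<^sub>R nc_matrix M up"
  have half: "(1/2) *\<^sub>R A + (1/2) *\<^sub>R A = A" for A :: "real ^ 7 ^ 7"
    by (simp flip: scaleR_add_left)
  have "(?Cp um up + ?Cm um up) + (?Cp up um + ?Cm up um) = nc_matrix M um + nc_matrix M up" for um up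
    using half[of "nc_matrix M um"] half[of "nc_matrix M up"] by (simp add: algebra_simps)
  then have "(\<forall>um\<in>\<Omega>. \<forall>up\<in>\<Omega>. d_minus M um up = ?Cm um up *v (up - um)
      \<and> d_plus M um up = ?Cp um up *v (up - um)
      \<and> (?Cp um up + ?Cm um up) + (?Cp up um + ?Cm up um) = nc_matrix M um + nc_matrix M up)
    \<and> (\<forall>u\<in>\<Omega>. ?Cp u u + ?Cm u u = nc_matrix M u)"
    by (simp only: d_minus_def d_plus_def d_col_eq_matrix half) simp
  then show ?thesis
    by (intro conjI impI exI[of _ ?Cm] exI[of _ ?Cp])
       (auto simp only: entropy_conservative_def consistent_fluxes entropy_balance_fluxes
         lipschitz_fluctuations)
qed

end
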